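(* Let $k\in\{1,2\}$. Suppose that there exists $\lambda^{kk}=(\lambda^{kk}_0,\lambda^{kk}_1,\lambda^{kk}_2)\in\mathbb{R}\times\mathbb{R}^3\times\mathbb{R}$ such that the function $$M_{kk}(v)=\exp\left(m_k\lambda^{kk}_0+m_k\lambda^{kk}_1\cdot v+m_k\lambda^{kk}_2|v|^2\right),\qquad v\in\mathbb{R}^3,$$ is an element of $\chi_k$. Then $M_{kk}$ is the unique minimizer of the problem $$\min_{g\in\chi_k}\int_{\mathbb{R}^3}\nu_{kk}\,h(g)\,dv .$$
   Context: Here $m_k>0$ is a particle mass, $\nu_{kk}:\mathbb{R}^3\to(0,\infty)$ is a given measurable (velocity-dependent) collision frequency, and $f_k:\mathbb{R}^3\to[0,\infty)$ is a given measurable function with $\nu_{kk}(1+|v|^2)f_k\in L^1(\mathbb{R}^3)$. The entropy function is $h(z)=z\ln z-z$ for $z>0$, with $h(0)=0$ by continuity. Set $$a^k(v)=\begin{pmatrix}m_k\\ m_kv\\ m_k|v|^2\end{pmatrix}\in\mathbb{R}^5$$ and $$\chi_k=\left\{g\ \Big|\ g\ge 0,\ \nu_{kk}(1+|v|^2)g\in L^1(\mathbb{R}^3),\ \int_{\mathbb{R}^3}\nu_{kk}\,a^k(v)\,(g-f_k)\,dv=0\right\}.$$ Functions are identified when they agree almost everywhere, and the objective $\int\nu_{kk}h(g)\,dv$ is an extended-real-valued integral (the value $+\infty$ is allowed). *)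

theory Defs
  imports "HOL-Analysis.Analysis"
begin

definition entropy_density :: "real \<Rightarrow> real" where
  "entropy_density z = (if z > 0 then z * ln z - z else 0)"

text \<open>The vector in five-dimensional space is split into its blocks, one for mass, three for
  momentum, one for energy.\<close>

definition moments :: "real \<Rightarrow> real^3 \<Rightarrow> real \<times> (real^3) \<times> real" where
  "moments m v = (m, m *\<^sub>R v, m * (norm v)\<^sup>2)"

text \<open>Elements are representatives of almost-everywhere classes, so nonnegativity is only
  required almost everywhere.  When \<open>nu\<close> is positive and \<open>f\<close> has finite weighted
  moments, the integrand of the moment constraint is integrable, so the Bochner integral below
  is not a default value.\<close>

definition admissible ::
  "real \<Rightarrow> (real^3 \<Rightarrow> real) \<Rightarrow> (real^3 \<Rightarrow> real) \<Rightarrow> (real^3 \<Rightarrow> real) set" where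
  "admissible m nu f = {g.
     g \<in> borel_measurable lebesgue \<and>
     (AE v in lebesgue. g v \<ge> 0) \<and>
     integrable lebesgue (\<lambda>v. nu v * (1 + (norm v)\<^sup>2) * g v) \<and>
     (LINT v|lebesgue. (nu v * (g v - f v)) *\<^sub>R moments m v) = 0}"

definition maxwellian :: "real \<Rightarrow> real \<Rightarrow> real^3 \<Rightarrow> real \<Rightarrow> real^3 \<Rightarrow> real" where
  "maxwellian m l0 l1 l2 v = exp (m * l0 + m * (l1 \<bullet> v) + m * l2 * (norm v)\<^sup>2)"

text \<open>The extended-real-valued integral, positive part minus negative part.  It is
  meaningful only if the two parts are not both infinite (in \<^typ>\<open>ereal\<close>,
  \<open>\<infinity> - \<infinity>\<close> evaluates to \<open>\<infinity>\<close>).\<close>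

definition ext_integral_exists :: "'a measure \<Rightarrow> ('a \<Rightarrow> real) \<Rightarrow> bool" where
  "ext_integral_exists M u \<longleftrightarrow> u \<in> borel_measurable M \<and>
     ((\<integral>\<^sup>+x. ennreal (u x) \<partial>M) < \<infinity> \<or> (\<integral>\<^sup>+x. ennreal (- u x) \<partial>M) < \<infinity>)"

definition ext_integral :: "'a measure \<Rightarrow> ('a \<Rightarrow> real) \<Rightarrow> ereal" where
  "ext_integral M u =
     enn2ereal (\<integral>\<^sup>+x. ennreal (u x) \<partial>M) - enn2ereal (\<integral>\<^sup>+x. ennreal (- u x) \<partial>M)"

definition entropy :: "(real^3 \<Rightarrow> real) \<Rightarrow> (real^3 \<Rightarrow> real) \<Rightarrow> ereal" where
  "entropy nu g = ext_integral lebesgue (\<lambda>v. nu v * entropy_density (g v))"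

definition is_minimizer_on :: "('a \<Rightarrow> ereal) \<Rightarrow> 'a set \<Rightarrow> 'a \<Rightarrow> bool" where
  "is_minimizer_on J S x \<longleftrightarrow> x \<in> S \<and> (\<forall>y\<in>S. J x \<le> J y)"

end

theory Submission imports Defs begin

text \<open>Write \<open>M = exp L\<close>, where \<open>L\<close> is a linear combination of the moments. The entropy density \<open>h\<close> is
  strictly convex, so it lies above its tangent at \<open>M\<close>: \<open>h z \<ge> L z - M\<close> with equality only at
  \<open>z = M\<close>. Multiplied by \<open>\<nu>\<close> and integrated, the right-hand side is finite and, by the
  moment constraints, takes the same value for every admissible \<open>g\<close>, in particular for \<open>g = M\<close>, where it
  is the entropy of \<open>M\<close>.\<close>

text \<open>For \<open>z > 0\<close>, dividing the gap to the tangent by \<open>z\<close> leaves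
  \<open>t - 1 - ln t\<close> with \<open>t = exp L / z\<close>. This is nonnegative and vanishes
  only at \<open>t = 1\<close>, which gives both the inequality and its equality case.\<close>

lemma entropy_density_tangent:
  assumes "z \<ge> 0"
  shows entropy_density_ge_tangent: "L * z - exp L \<le> entropy_density z"
    and entropy_density_eq_tangent_iff: "entropy_density z = L * z - exp L \<longleftrightarrow> z = exp L"
proof -
  have "L * z - exp L \<le> entropy_density z \<and> (entropy_density z = L * z - exp L \<longrightarrow> z = exp L)"
  proof (cases "z = 0")
    case True
    then show ?thesis by (simp add: entropy_density_def)
  next
    case False
    with assms have z: "z > 0" by simp
    define t where "t = exp L / z"
    have t: "t > 0" and zt: "exp L = z * t" using z by (simp_all add: t_def)
    have "L = ln z + ln t" by (metis ln_exp ln_mult_pos t z zt)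
    then have gap: "entropy_density z - (L * z - exp L) = z * (t - 1 - ln t)"
      using z t by (simp add: entropy_density_def exp_add algebra_simps)
    have "0 \<le> t - 1 - ln t" using ln_le_minus_one[OF t] by simp
    with z have "0 \<le> z * (t - 1 - ln t)" by simp
    moreover have "z = exp L" if "z * (t - 1 - ln t) = 0"
      using that z ln_eq_minus_one[OF t] zt by simp
    ultimately show ?thesis using gap by (metis diff_ge_0_iff_ge diff_self)
  qed
  moreover have "entropy_density (exp L) = L * exp L - exp L"
    by (simp add: entropy_density_def)
  ultimately show "L * z - exp L \<le> entropy_density z"
    and "entropy_density z = L * z - exp L \<longleftrightarrow> z = exp L" by auto
qed

lemma borel_measurable_entropy_density [measurable]: "entropy_density \<in> borel_measurable borel"
  unfolding entropy_density_def by measurable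

lemma ext_integral_eq_integral:
  assumes "integrable M u"
  shows "ext_integral M u = ereal (LINT x|M. u x)"
proof -
  have fin: "(\<integral>\<^sup>+x. ennreal (u x) \<partial>M) \<noteq> \<infinity>" "(\<integral>\<^sup>+x. ennreal (- u x) \<partial>M) \<noteq> \<infinity>"
    using assms by (auto simp: real_integrable_def)
  show ?thesis
    unfolding ext_integral_def real_lebesgue_integral_def[OF assms]
    using fin by (cases "\<integral>\<^sup>+x. ennreal (u x) \<partial>M"; cases "\<integral>\<^sup>+x. ennreal (- u x) \<partial>M") 
      (auto simp: enn2ereal_ennreal)
qed

text \<open>An integrable minorant keeps the negative part of \<open>u\<close> finite, so infinity
  minus infinity never arises. In the equality case \<open>u - b\<close> is nonnegative almost
  everywhere with integral at most 0, hence it vanishes almost everywhere.\<close>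

lemma ext_integral_lower_bound:
  assumes [measurable]: "u \<in> borel_measurable M" and b: "integrable M b"
    and le: "AE x in M. b x \<le> u x"
  shows ext_integral_exists_if_bounded_below: "ext_integral_exists M u"
    and ext_integral_ge: "ereal (LINT x|M. b x) \<le> ext_integral M u"
    and ext_integral_le_imp_AE_eq:
      "ext_integral M u \<le> ereal (LINT x|M. b x) \<Longrightarrow> AE x in M. u x = b x"
proof -
  have "(\<integral>\<^sup>+x. ennreal (- u x) \<partial>M) \<le> (\<integral>\<^sup>+x. ennreal (- b x) \<partial>M)"
    using le by (intro nn_integral_mono_AE) (auto elim!: eventually_mono intro: ennreal_leI)
  also have "\<dots> < \<infinity>"
    using b by (auto simp: real_integrable_def less_top)
  finally have neg: "(\<integral>\<^sup>+x. ennreal (- u x) \<partial>M) < \<infinity>" .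
  then show "ext_integral_exists M u"
    by (simp add: ext_integral_exists_def)
  \<comment> \<open>As the negative part is finite, only the positive part decides between an
    ordinary integral and the value \<open>\<infinity>\<close>.\<close>
  consider (fin) "integrable M u" | (inf) "ext_integral M u = \<infinity>"
  proof (cases "(\<integral>\<^sup>+x. ennreal (u x) \<partial>M) = \<infinity>")
    case True
    with neg have "ext_integral M u = \<infinity>" by (simp add: ext_integral_def)
    then show ?thesis using that by blast
  next
    case False
    with neg have "integrable M u" by (auto simp: real_integrable_def)
    then show ?thesis using that by blast
  qed
  note cs = this
  show "ereal (LINT x|M. b x) \<le> ext_integral M u"
    using cs
  proof cases
    case fin
    then show ?thesis
      using integral_mono_AE[OF b fin le] by (simp add: ext_integral_eq_integral)
  qed simp
  show "AE x in M. u x = b x" if small: "ext_integral M u \<le> ereal (LINT x|M. b x)"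
    using cs
  proof cases
    case fin
    have int: "integrable M (\<lambda>x. u x - b x)" using fin b by simp
    have ge: "AE x in M. 0 \<le> u x - b x" using le by simp
    have "(LINT x|M. u x - b x) \<le> 0"
      using small fin b by (simp add: ext_integral_eq_integral)
    moreover have "(LINT x|M. u x - b x) \<ge> 0"
      using ge by (rule integral_nonneg_AE)
    ultimately have "AE x in M. u x - b x = 0"
      using integral_nonneg_eq_0_iff_AE[OF int ge] by simp
    then show ?thesis by simp
  next
    case inf
    with small show ?thesis by simp
  qed
qed

lemma norm_moments_le: "norm (moments m v) \<le> 2 * \<bar>m\<bar> * (1 + (norm v)\<^sup>2)"
proof -
  have "norm (moments m v) \<le> \<bar>m\<bar> + (\<bar>m\<bar> * norm v + \<bar>m\<bar> * (norm v)\<^sup>2)"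
    using norm_Pair_le[of m "(m *\<^sub>R v, m * (norm v)\<^sup>2)"]
      norm_Pair_le[of "m *\<^sub>R v" "m * (norm v)\<^sup>2"]
    by (simp add: moments_def abs_mult)
  also have "\<dots> = \<bar>m\<bar> * (1 + norm v + (norm v)\<^sup>2)" by (simp add: algebra_simps)
  also have "\<dots> \<le> \<bar>m\<bar> * (2 * (1 + (norm v)\<^sup>2))"
  proof (rule mult_left_mono)
    \<comment> \<open>With n the norm of \<open>v\<close>, n is at most 2n, which is at most n
      squared plus 1; this accounts for the factor 2.\<close>
    show "1 + norm v + (norm v)\<^sup>2 \<le> 2 * (1 + (norm v)\<^sup>2)"
      using sum_squares_bound[of "norm v" 1] norm_ge_zero[of v]
      unfolding power_one mult_1_right by (simp only: distrib_left)
  qed simp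
  finally show ?thesis by (simp only: mult_ac)
qed

lemma borel_measurable_moments [measurable]: "moments m \<in> borel_measurable borel"
  unfolding moments_def by measurable

text \<open>The logarithm of the Maxwellian is a linear functional of the moments, which is what
  lets the constraints fix its weighted integral against any admissible function.\<close>

lemma maxwellian_eq_exp_moments:
  "maxwellian m l0 l1 l2 v = exp (moments m v \<bullet> (l0, l1, l2))"
  by (simp add: maxwellian_def moments_def inner_commute algebra_simps)

text \<open>The weight in the integrability hypothesis dominates all moments at once by
  \<open>norm_moments_le\<close>, so the moment integrals are genuine and not default
  values.\<close>

lemma integrable_scaleR_moments:
  assumes nu [measurable]: "nu \<in> borel_measurable lebesgue"
    and g [measurable]: "g \<in> borel_measurable lebesgue"
    and int: "integrable lebesgue (\<lambda>v. nu v * (1 + (norm v)\<^sup>2) * g v)"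
  shows "integrable lebesgue (\<lambda>v. (nu v * g v) *\<^sub>R moments m v)"
proof (rule Bochner_Integration.integrable_bound)
  show "integrable lebesgue (\<lambda>v. 2 * \<bar>m\<bar> * (nu v * (1 + (norm v)\<^sup>2) * g v))"
    using int by simp
  have [measurable]: "moments m \<in> borel_measurable lebesgue"
    by (simp add: borel_measurable_moments measurable_completion)
  show "(\<lambda>v. (nu v * g v) *\<^sub>R moments m v) \<in> borel_measurable lebesgue"
    by measurable
  have "norm ((nu v * g v) *\<^sub>R moments m v)
      \<le> norm (2 * \<bar>m\<bar> * (nu v * (1 + (norm v)\<^sup>2) * g v))" for v
  proof -
    have "\<bar>nu v * g v\<bar> * norm (moments m v) \<le> \<bar>nu v * g v\<bar> * (2 * \<bar>m\<bar> * (1 + (norm v)\<^sup>2))"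
      by (intro mult_left_mono norm_moments_le) simp
    also have "\<dots> = norm (2 * \<bar>m\<bar> * (nu v * (1 + (norm v)\<^sup>2) * g v))"
      by (simp add: abs_mult)
    finally show ?thesis by simp
  qed
  then show "AE v in lebesgue. norm ((nu v * g v) *\<^sub>R moments m v)
      \<le> norm (2 * \<bar>m\<bar> * (nu v * (1 + (norm v)\<^sup>2) * g v))" by simp
qed

lemma integrable_weighted:
  fixes nu g :: "real^3 \<Rightarrow> real"
  assumes [measurable]: "nu \<in> borel_measurable lebesgue" "g \<in> borel_measurable lebesgue"
    and int: "integrable lebesgue (\<lambda>v. nu v * (1 + (norm v)\<^sup>2) * g v)"
  shows "integrable lebesgue (\<lambda>v. nu v * g v)"
proof -
  \<comment> \<open>For mass 1, pairing with \<open>(1, 0, 0)\<close> selects the mass component,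
    which is the constant 1.\<close>
  have "integrable lebesgue (\<lambda>v. ((nu v * g v) *\<^sub>R moments 1 v) \<bullet> (1, 0, 0))"
    using integrable_scaleR_moments[OF assms] by (rule integrable_inner_left)
  then show ?thesis by (simp add: moments_def)
qed

lemma admissible_integral_moments:
  assumes nu: "nu \<in> borel_measurable lebesgue"
    and f: "f \<in> borel_measurable lebesgue"
    and fint: "integrable lebesgue (\<lambda>v. nu v * (1 + (norm v)\<^sup>2) * f v)"
    and g: "g \<in> admissible m nu f"
  shows "(LINT v|lebesgue. (nu v * g v) *\<^sub>R moments m v)
       = (LINT v|lebesgue. (nu v * f v) *\<^sub>R moments m v)"
proof -
  have gm: "g \<in> borel_measurable lebesgue"
    and gint: "integrable lebesgue (\<lambda>v. nu v * (1 + (norm v)\<^sup>2) * g v)"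
    and g0: "(LINT v|lebesgue. (nu v * (g v - f v)) *\<^sub>R moments m v) = 0"
    using g by (auto simp: admissible_def)
  have "(LINT v|lebesgue. (nu v * g v) *\<^sub>R moments m v)
      - (LINT v|lebesgue. (nu v * f v) *\<^sub>R moments m v)
      = (LINT v|lebesgue. (nu v * g v) *\<^sub>R moments m v - (nu v * f v) *\<^sub>R moments m v)"
    using integrable_scaleR_moments[OF nu gm gint] integrable_scaleR_moments[OF nu f fint]
    by (rule Bochner_Integration.integral_diff[symmetric])
  also have "\<dots> = 0" using g0 by (simp add: algebra_simps)
  finally show ?thesis by simp
qed

theorem theorem2p1:
  fixes m :: "nat \<Rightarrow> real"
    and nu :: "nat \<Rightarrow> nat \<Rightarrow> real^3 \<Rightarrow> real"
    and f :: "nat \<Rightarrow> real^3 \<Rightarrow> real"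
    and k :: nat
    and l0 :: real and l1 :: "real^3" and l2 :: real
  assumes "k \<in> {1, 2}"
    and "m k > 0"
    and "nu k k \<in> borel_measurable lebesgue"
    and "\<And>v. nu k k v > 0"
    and "f k \<in> borel_measurable lebesgue"
    and "\<And>v. f k v \<ge> 0"
    and "integrable lebesgue (\<lambda>v. nu k k v * (1 + (norm v)\<^sup>2) * f k v)"
    and "maxwellian (m k) l0 l1 l2 \<in> admissible (m k) (nu k k) (f k)"
  shows "(\<forall>g \<in> admissible (m k) (nu k k) (f k).
            ext_integral_exists lebesgue (\<lambda>v. nu k k v * entropy_density (g v))) \<and>
         is_minimizer_on (entropy (nu k k)) (admissible (m k) (nu k k) (f k))
            (maxwellian (m k) l0 l1 l2) \<and>
         (\<forall>g. is_minimizer_on (entropy (nu k k)) (admissible (m k) (nu k k) (f k)) g \<longrightarrow>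
            (AE v in lebesgue. g v = maxwellian (m k) l0 l1 l2 v))"
proof -
  define N where "N = nu k k"
  define F where "F = f k"
  define M where "M = maxwellian (m k) l0 l1 l2"
  define A where "A = admissible (m k) N F"
  define L where "L v = moments (m k) v \<bullet> (l0, l1, l2)" for v
  \<comment> \<open>\<open>b g v\<close> is the tangent of the entropy density at
    \<open>M v\<close>, evaluated at \<open>g v\<close> and weighted by \<open>N v\<close>; its
    slope is \<open>L v\<close>, the logarithm of \<open>M v\<close>.\<close>
  define b where "b g v = N v * (L v * g v - M v)" for g v
  have N [measurable]: "N \<in> borel_measurable lebesgue" and Npos: "N v > 0" for v
    using assms by (simp_all add: N_def)
  have M_exp: "M v = exp (L v)" for v
    by (simp add: M_def L_def maxwellian_eq_exp_moments)
  have MA: "M \<in> A" using assms by (simp add: M_def A_def N_def F_def)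
  have AD: "g \<in> borel_measurable lebesgue" "AE v in lebesgue. g v \<ge> 0"
    "integrable lebesgue (\<lambda>v. N v * (1 + (norm v)\<^sup>2) * g v)" if "g \<in> A" for g
    using that by (auto simp: A_def admissible_def)
  have NM: "integrable lebesgue (\<lambda>v. N v * M v)"
    by (rule integrable_weighted[OF N AD(1,3)[OF MA]])
  have NLg: "integrable lebesgue (\<lambda>v. N v * (L v * g v))"
    and NLg_eq: "(LINT v|lebesgue. N v * (L v * g v))
      = (LINT v|lebesgue. (N v * F v) *\<^sub>R moments (m k) v) \<bullet> (l0, l1, l2)"
    if g: "g \<in> A" for g
  proof -
    \<comment> \<open>The multipliers do not depend on \<open>v\<close>, so their inner product with
      the moments can be taken outside the integral, leaving only the moments fixed by the
      constraint.\<close>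
    have eq: "(\<lambda>v. N v * (L v * g v))
        = (\<lambda>v. ((N v * g v) *\<^sub>R moments (m k) v) \<bullet> (l0, l1, l2))"
      by (auto simp: L_def algebra_simps)
    have int: "integrable lebesgue (\<lambda>v. (N v * g v) *\<^sub>R moments (m k) v)"
      by (rule integrable_scaleR_moments[OF N AD(1,3)[OF g]])
    show "integrable lebesgue (\<lambda>v. N v * (L v * g v))"
      unfolding eq using int by (rule integrable_inner_left)
    have "(LINT v|lebesgue. N v * (L v * g v))
        = (LINT v|lebesgue. (N v * g v) *\<^sub>R moments (m k) v) \<bullet> (l0, l1, l2)"
      unfolding eq using int by (intro integral_inner_left)
    also have "(LINT v|lebesgue. (N v * g v) *\<^sub>R moments (m k) v)
        = (LINT v|lebesgue. (N v * F v) *\<^sub>R moments (m k) v)"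
      using assms g by (intro admissible_integral_moments) (simp_all add: N_def F_def A_def)
    finally show "(LINT v|lebesgue. N v * (L v * g v))
      = (LINT v|lebesgue. (N v * F v) *\<^sub>R moments (m k) v) \<bullet> (l0, l1, l2)" .
  qed
  have b_int: "integrable lebesgue (b g)" if "g \<in> A" for g
    unfolding b_def right_diff_distrib using NLg[OF that] NM by simp
  have b_eq: "integral\<^sup>L lebesgue (b g) = integral\<^sup>L lebesgue (b M)" if "g \<in> A" for g
    unfolding b_def right_diff_distrib using that MA NM by (simp add: NLg NLg_eq)
  have meas: "(\<lambda>v. N v * entropy_density (g v)) \<in> borel_measurable lebesgue" if "g \<in> A" for g
    using AD(1)[OF that] by measurable
  have le: "AE v in lebesgue. b g v \<le> N v * entropy_density (g v)" if "g \<in> A" for g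
    using AD(2)[OF that]
    by eventually_elim
      (auto simp: b_def M_exp intro!: mult_left_mono entropy_density_ge_tangent
        less_imp_le[OF Npos])
  \<comment> \<open>The tangent touches the entropy density at \<open>M v\<close>, so the minorant
    is attained pointwise by \<open>M\<close>.\<close>
  have "(\<lambda>v. N v * entropy_density (M v)) = b M"
    using entropy_density_eq_tangent_iff by (fastforce simp: b_def M_exp)
  then have entropy_M: "entropy N M = ereal (integral\<^sup>L lebesgue (b M))"
    using b_int[OF MA] by (simp add: entropy_def ext_integral_eq_integral)
  note bound = ext_integral_lower_bound[OF meas b_int le, folded entropy_def]
  have ex: "\<forall>g\<in>A. ext_integral_exists lebesgue (\<lambda>v. N v * entropy_density (g v))"
    using bound(1) by blast
  have min: "is_minimizer_on (entropy N) A M"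
    unfolding is_minimizer_on_def
  proof (intro conjI ballI MA)
    show "entropy N M \<le> entropy N g" if "g \<in> A" for g
      using bound(2)[OF that that that] unfolding entropy_M b_eq[OF that] .
  qed
  have uniq: "AE v in lebesgue. g v = M v" if "is_minimizer_on (entropy N) A g" for g
  proof -
    from that have g: "g \<in> A" and "entropy N g \<le> entropy N M"
      using MA by (auto simp: is_minimizer_on_def)
    \<comment> \<open>By \<open>b_eq\<close> the entropy of \<open>M\<close> is also the integral of
      \<open>b g\<close>. A minimizer therefore does not exceed the integral of its own minorant,
      which is the equality case.\<close>
    then have "AE v in lebesgue. N v * entropy_density (g v) = b g v"
      using bound(3)[OF g g g] unfolding entropy_M b_eq[OF g] by blast
    \<comment> \<open>At a negative argument the density is 0 and may meet the tangent by accident,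
      so the equality is read off where \<open>g\<close> is nonnegative, after cancelling the
      positive weight \<open>N v\<close>.\<close>
    with AD(2)[OF g] show ?thesis
    proof eventually_elim
      case (elim v)
      then have "entropy_density (g v) = L v * g v - exp (L v)"
        using Npos[of v] by (simp add: b_def M_exp)
      with elim(1) show ?case
        by (simp add: entropy_density_eq_tangent_iff M_exp)
    qed
  qed
  show ?thesis
    using ex min uniq unfolding N_def F_def A_def M_def by blast
qed

end
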